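(* For each integer $m\geqslant0$, $$\delta([\underbrace{2,\ldots,2}_m])=\sum_{\mathbf{a}\in\mathcal{A}_{2m}^{\{2,4\}}}c_{\mathbf{a}}\,\mathbf{a},$$ where $\mathcal{A}_{2m}^{\{2,4\}}$ is the set of compositions of weight $2m$ all of whose entries belong to $\{2,4\}$, and for such $\mathbf{a}=(a_1,\ldots,a_r)$, $c_{\mathbf{a}}=3\cdot2^{s-1}$ if $a_1=2$ and $c_{\mathbf{a}}=2^s$ otherwise, with $s=2r-m$ the number of indices $i$ with $a_i=2$.
   Context: A composition is a finite sequence $\mathbf{a}=(a_1,\ldots,a_r)$ of positive integers ($r\geqslant0$), of weight $\sum a_i$; admissible if $r=0$ or $a_1\geqslant2$. $\mathcal{A}$ (resp. $\mathcal{A}_k$) is the set of admissible compositions (resp. of weight $k$). Binary word $\mathbf{w}(\mathbf{a})=0^{a_1-1}1\cdots0^{a_r-1}1$; the dual of a word $\varepsilon_1\cdots\varepsilon_k$ is $\overline{\varepsilon_k}\cdots\overline{\varepsilon_1}$ ($\overline0=1,\overline1=0$); $\overline{\mathbf{a}}$ is the admissible composition with word dual to $\mathbf{w}(\mathbf{a})$. $\mathcal{B}=\mathcal{A}/(\mathbf{a}\sim\overline{\mathbf{a}})$, classes $[\mathbf{a}]$, $\mathcal{B}_k$ classes of weight $k$; $\mathbf{Z}^{(X)}$ is the free $\mathbf{Z}$-module on $X$. $(a_1,\ldots,a_r)^{\rm init}=(a_1,\ldots,a_{r-1})$ ($\varnothing^{\rm init}=\varnothing$); for admissible $\mathbf{a}$,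 $\mathbf{a}^{\rm fin}$ is the dual of $(\overline{\mathbf{a}})^{\rm init}$ and $\mathbf{a}^{\rm mid}=(\mathbf{a}^{\rm fin})^{\rm init}$; extended $\mathbf{Z}$-linearly. $\delta$ is the unique $\mathbf{Z}$-linear map $\mathbf{Z}^{(\mathcal{B})}\to\mathbf{Z}^{(\mathcal{A})}$ with $\delta(\mathbf{Z}^{\mathcal{B}_k})\subset\mathbf{Z}^{\mathcal{A}_k}$ for all $k$, $\delta([\varnothing])=\varnothing$, and $\delta([\mathbf{a}])^{\rm init}=\delta([\mathbf{a}^{\rm init}])+\delta([\mathbf{a}^{\rm mid}])+\delta([\mathbf{a}^{\rm fin}])$ for all non-empty admissible $\mathbf{a}$. *)

theory Defs
  imports Complex_Main "HOL-Library.Poly_Mapping"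
begin

definition composition :: "nat list \<Rightarrow> bool" where
  "composition a \<longleftrightarrow> (\<forall>x \<in> set a. 1 \<le> x)"

definition admissible :: "nat list \<Rightarrow> bool" where
  "admissible a \<longleftrightarrow> composition a \<and> (a = [] \<or> 2 \<le> hd a)"

typedef adm_comp = "{a. admissible a}"
  morphisms entries Adm
  by (rule exI[of _ "[]"]) (simp add: admissible_def composition_def)

setup_lifting type_definition_adm_comp

lift_definition empty_comp :: adm_comp is "[]"
  by (simp add: admissible_def composition_def)

definition weight :: "adm_comp \<Rightarrow> nat" where
  "weight a = sum_list (entries a)"

definition adm_of_weight :: "nat \<Rightarrow> adm_comp set" where
  "adm_of_weight k = {a. weight a = k}"

text \<open>Binary words are lists of Booleans: \<open>False\<close> is the letter 0 and \<open>True\<close> the letter 1.\<close>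

definition word :: "nat list \<Rightarrow> bool list" where
  "word a = concat (map (\<lambda>x. replicate (x - 1) False @ [True]) a)"

definition dual_word :: "bool list \<Rightarrow> bool list" where
  "dual_word v = map Not (rev v)"

definition dual :: "adm_comp \<Rightarrow> adm_comp" where
  "dual a = (THE b. word (entries b) = dual_word (word (entries a)))"

lemma word_Nil [simp]: "word [] = []"
  and word_Cons [simp]: "word (x # xs) = replicate (x - 1) False @ True # word xs"
  and word_append [simp]: "word (xs @ ys) = word xs @ word ys"
  by (simp_all add: word_def)

lemma composition_simps [simp]:
  "composition []"
  "composition (x # xs) \<longleftrightarrow> 1 \<le> x \<and> composition xs"
  "composition (xs @ ys) \<longleftrightarrow> composition xs \<and> composition ys"
  by (auto simp: composition_def)

lemma replicate_False_True_eq: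
  "replicate m False @ True # v = replicate n False @ True # w \<longleftrightarrow> m = n \<and> v = w"
proof (induction m arbitrary: n)
  case 0
  show ?case by (cases n) auto
next
  case (Suc m)
  show ?case by (cases n) (auto simp: Suc.IH)
qed

lemma word_inj:
  "composition a \<Longrightarrow> composition b \<Longrightarrow> word a = word b \<Longrightarrow> a = b"
proof (induction a arbitrary: b)
  case Nil
  then show ?case by (cases b) auto
next
  case (Cons x a)
  then show ?case by (cases b) (auto simp: replicate_False_True_eq)
qed

lemma word_surj:
  "v = [] \<or> last v \<Longrightarrow> \<exists>a. composition a \<and> word a = v"
proof (induction v)
  case Nil
  show ?case by (rule exI[of _ "[]"]) simp
next
  case (Cons c v)
  then obtain a where a: "composition a" "word a = v"
    by (auto split: if_splits)
  show ?case
  proof (cases c)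
    case True
    with a show ?thesis by (intro exI[of _ "1 # a"]) simp
  next
    case False
    with Cons.prems a obtain x a' where "a = x # a'"
      by (cases a) auto
    with a False show ?thesis
      by (intro exI[of _ "Suc x # a'"]) (cases x; simp)
  qed
qed

lemma word_last: "a \<noteq> [] \<Longrightarrow> last (word a)"
  by (induction a rule: rev_induct) auto

lemma word_eq_Nil [simp]: "word a = [] \<longleftrightarrow> a = []"
  by (cases a) auto

lemma word_hd: "a \<noteq> [] \<Longrightarrow> composition a \<Longrightarrow> hd (word a) \<longleftrightarrow> hd a = 1"
proof (cases a)
  case (Cons x xs)
  assume "composition a"
  with Cons show ?thesis by (cases "x - 1") auto
qed simp

lemma admissible_entries [simp]: "admissible (entries a)"
  using entries by blast

lemma composition_entries [simp]: "composition (entries a)"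
  using admissible_entries unfolding admissible_def by blast

lemma word_entries_inj: "word (entries a) = word (entries b) \<Longrightarrow> a = b"
  by (rule iffD1[OF entries_inject], rule word_inj) auto

lemma dual_word_involution [simp]: "dual_word (dual_word v) = v"
  by (simp add: dual_word_def rev_map o_def)

lemma word_dual: "word (entries (dual a)) = dual_word (word (entries a))"
proof -
  have "\<exists>b. word (entries b) = dual_word (word (entries a))"
  proof (cases "entries a = []")
    case True
    then show ?thesis by (intro exI[of _ a]) (simp add: dual_word_def)
  next
    case False
    let ?w = "word (entries a)"
    have hd: "\<not> hd ?w"
      using False word_hd[OF False] admissible_entries[of a] by (auto simp: admissible_def)
    have w: "?w \<noteq> []" using False by simp
    have "last (dual_word ?w)"
      using w hd by (simp add: dual_word_def last_map last_rev)
    then obtain b where b: "composition b" "word b = dual_word ?w"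
      using word_surj by blast
    have "\<not> hd (word b)"
      using w word_last[OF False] by (simp add: b dual_word_def hd_map hd_rev)
    moreover have "b \<noteq> []" using b w by (auto simp: dual_word_def)
    ultimately have "hd b \<noteq> 1" using word_hd b by blast
    moreover have "1 \<le> hd b"
      using b \<open>b \<noteq> []\<close> by (cases b) auto
    ultimately have "admissible b"
      using b by (simp add: admissible_def)
    then show ?thesis
      using b by (intro exI[of _ "Adm b"]) (simp add: Adm_inverse)
  qed
  then have "\<exists>!b. word (entries b) = dual_word (word (entries a))"
    by (metis word_entries_inj)
  then show ?thesis
    unfolding dual_def by (rule theI')
qed

lemma dual_dual [simp]: "dual (dual a) = a"
  by (rule word_entries_inj) (simp add: word_dual)

definition dual_equiv :: "adm_comp \<Rightarrow> adm_comp \<Rightarrow> bool" where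
  "dual_equiv a b \<longleftrightarrow> b = a \<or> b = dual a"

quotient_type dual_class = adm_comp / dual_equiv
  morphisms rep_class cls
  by (rule equivpI) (auto simp: reflp_def symp_def transp_def dual_equiv_def)

definition classes_of_weight :: "nat \<Rightarrow> dual_class set" where
  "classes_of_weight k = cls ` adm_of_weight k"

lift_definition init :: "adm_comp \<Rightarrow> adm_comp" is butlast
proof -
  fix a assume "admissible a"
  then show "admissible (butlast a)"
    by (cases a rule: rev_cases; cases "butlast a")
      (auto simp: admissible_def hd_append split: if_splits)
qed

definition fin :: "adm_comp \<Rightarrow> adm_comp" where
  "fin a = dual (init (dual a))"

definition mid :: "adm_comp \<Rightarrow> adm_comp" where
  "mid a = init (fin a)"

text \<open>The free \<open>\<int>\<close>-module on \<open>X\<close> is \<open>X \<Rightarrow>\<^sub>0 int\<close>; for a subset \<open>S\<close> of the basis, the free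
  module on \<open>S\<close> is the submodule of elements supported in \<open>S\<close>.\<close>

definition supported_in :: "'a set \<Rightarrow> ('a \<Rightarrow>\<^sub>0 int) set" where
  "supported_in S = {x. Poly_Mapping.keys x \<subseteq> S}"

definition init_lin :: "(adm_comp \<Rightarrow>\<^sub>0 int) \<Rightarrow> (adm_comp \<Rightarrow>\<^sub>0 int)" where
  "init_lin = frag_extend (\<lambda>a. frag_of (init a))"

definition is_delta :: "((dual_class \<Rightarrow>\<^sub>0 int) \<Rightarrow> (adm_comp \<Rightarrow>\<^sub>0 int)) \<Rightarrow> bool" where
  "is_delta D \<longleftrightarrow>
     module_hom frag_cmul frag_cmul D \<and>
     (\<forall>k. D ` supported_in (classes_of_weight k) \<subseteq> supported_in (adm_of_weight k)) \<and>
     D (frag_of (cls empty_comp)) = frag_of empty_comp \<and>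
     (\<forall>a. a \<noteq> empty_comp \<longrightarrow>
        init_lin (D (frag_of (cls a))) =
          D (frag_of (cls (init a))) + D (frag_of (cls (mid a))) + D (frag_of (cls (fin a))))"

definition delta :: "(dual_class \<Rightarrow>\<^sub>0 int) \<Rightarrow> (adm_comp \<Rightarrow>\<^sub>0 int)" where
  "delta = (THE D. is_delta D)"

lift_definition twos :: "nat \<Rightarrow> adm_comp" is "\<lambda>m. replicate m 2"
proof -
  show "admissible (replicate m 2)" for m
    by (cases m) (auto simp: admissible_def composition_def)
qed

text \<open>Lists with entries in \<open>{2, 4}\<close> are automatically admissible, see \<open>admissible_24\<close> below.\<close>

definition adm24_of_weight :: "nat \<Rightarrow> adm_comp set" where
  "adm24_of_weight k = {a. weight a = k \<and> set (entries a) \<subseteq> {2, 4}}"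

text \<open>For compositions of weight \<open>2 * m\<close> with \<open>r\<close> entries, all in \<open>{2, 4}\<close>, this number is
  \<open>2 * r - m\<close>, see \<open>num_twos_eq\<close> below.\<close>

definition num_twos :: "adm_comp \<Rightarrow> nat" where
  "num_twos a = card {i. i < length (entries a) \<and> entries a ! i = 2}"

definition coeff24 :: "adm_comp \<Rightarrow> int" where
  "coeff24 a =
     (if entries a \<noteq> [] \<and> hd (entries a) = 2 then 3 * 2 ^ (num_twos a - 1) else 2 ^ num_twos a)"

lemma num_twos_eq:
  assumes "a \<in> adm24_of_weight (2 * m)"
  shows "int (num_twos a) = 2 * int (length (entries a)) - int m"
proof -
  have "int (sum_list xs) = 4 * int (length xs) - 2 * int (length (filter (\<lambda>x. x = 2) xs))"
    if "set xs \<subseteq> {2, 4}" for xs :: "nat list"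
    using that by (induction xs) auto
  from this[of "entries a"] show ?thesis
    using assms by (auto simp: adm24_of_weight_def weight_def num_twos_def length_filter_conv_card)
qed

lemma finite_adm24: "finite (adm24_of_weight k)"
proof -
  have len: "length xs \<le> sum_list xs" if "set xs \<subseteq> {2, 4}" for xs :: "nat list"
    using that by (induction xs) auto
  have "entries ` adm24_of_weight k \<subseteq> {xs. set xs \<subseteq> {2, 4} \<and> length xs \<le> k}"
    using len by (auto simp: adm24_of_weight_def weight_def)
  moreover have "finite {xs::nat list. set xs \<subseteq> {2, 4} \<and> length xs \<le> k}"
    by (rule finite_lists_length_le) simp
  ultimately have "finite (entries ` adm24_of_weight k)"
    by (rule finite_subset)
  then show ?thesis
    by (rule finite_imageD) (simp add: inj_on_def entries_inject)
qed

lemma admissible_24: "set xs \<subseteq> {2, 4} \<Longrightarrow> admissible xs"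
  by (cases xs) (auto simp: admissible_def composition_def)

text \<open>The map \<open>delta\<close> is well defined: exactly one map satisfies \<open>is_delta\<close>.\<close>

lemma length_word: "composition a \<Longrightarrow> length (word a) = sum_list a"
  by (induction a) auto

lemma weight_dual [simp]: "weight (dual a) = weight a"
  unfolding weight_def
  by (metis composition_entries length_word word_dual dual_word_def length_map length_rev)

lemma init_empty [simp]: "init empty_comp = empty_comp"
  by transfer simp

lemma entries_eq_Nil: "entries a = [] \<longleftrightarrow> a = empty_comp"
  by transfer simp

lemma dual_empty [simp]: "dual empty_comp = empty_comp"
  by (rule word_entries_inj) (simp add: word_dual empty_comp.rep_eq dual_word_def)

lemma dual_eq_empty [simp]: "dual a = empty_comp \<longleftrightarrow> a = empty_comp"
  by (metis dual_dual dual_empty)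

lemma fin_empty [simp]: "fin empty_comp = empty_comp"
  by (simp add: fin_def)

lemma weight_init_less: "a \<noteq> empty_comp \<Longrightarrow> weight (init a) < weight a"
proof -
  assume "a \<noteq> empty_comp"
  then obtain b y where "entries a = b @ [y]"
    using entries_eq_Nil rev_exhaust by metis
  moreover have "1 \<le> y" using composition_entries[of a] calculation by simp
  ultimately show ?thesis by (simp add: weight_def init.rep_eq)
qed

lemma weight_init_le: "weight (init a) \<le> weight a"
  by (cases "a = empty_comp") (auto dest: weight_init_less)

lemma weight_fin_less: "a \<noteq> empty_comp \<Longrightarrow> weight (fin a) < weight a"
  unfolding fin_def using weight_init_less[of "dual a"] by simp

lemma weight_mid_less: "a \<noteq> empty_comp \<Longrightarrow> weight (mid a) < weight a"
  unfolding mid_def using weight_init_le[of "fin a"] weight_fin_less[of a] by simp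

lemma dropWhile_replicate_append:
  "P x \<Longrightarrow> dropWhile P (replicate n x @ v) = dropWhile P v"
  by (induction n) auto

lemma word_butlast:
  assumes "a \<noteq> []"
  shows "word (butlast a) = rev (dropWhile Not (tl (rev (word a))))"
proof -
  obtain b y where a: "a = b @ [y]" using assms rev_exhaust by blast
  have "dropWhile Not (rev (word b)) = rev (word b)"
    by (cases b rule: rev_cases) simp_all
  then show ?thesis by (simp add: a dropWhile_replicate_append)
qed

lemma word_fin:
  assumes "a \<noteq> empty_comp"
  shows "word (entries (fin a)) = dropWhile id (tl (word (entries a)))"
proof -
  have "entries (dual a) \<noteq> []" using assms by (simp add: entries_eq_Nil)
  then show ?thesis
    by (simp add: fin_def word_dual init.rep_eq word_butlast dual_word_def rev_map
        map_tl[symmetric] dropWhile_map o_def id_def)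
qed

lemma word_dropWhile_1:
  "composition xs \<Longrightarrow> word (dropWhile (\<lambda>x. x = 1) xs) = dropWhile id (word xs)"
proof (induction xs)
  case (Cons x xs)
  show ?case
  proof (cases "x = 1")
    case False
    with Cons.prems obtain n where "x = Suc (Suc n)"
      by (cases x; cases "x - 1") auto
    then show ?thesis by simp
  qed (use Cons in simp)
qed simp

lemma entries_fin:
  assumes "entries a = x # xs"
  shows "entries (fin a) = (if x = 2 then dropWhile (\<lambda>x. x = 1) xs else (x - 1) # xs)"
proof (rule word_inj)
  have adm: "2 \<le> x" "composition xs"
    using admissible_entries[of a] by (auto simp: assms admissible_def)
  have ne: "a \<noteq> empty_comp" using assms entries_eq_Nil[of a] by auto
  obtain n where x: "x = Suc (Suc n)"
    using adm by (cases x; cases "x - 1") auto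
  show "word (entries (fin a)) = word (if x = 2 then dropWhile (\<lambda>x. x = 1) xs else (x - 1) # xs)"
    unfolding word_fin[OF ne] assms using word_dropWhile_1[OF adm(2)]
    by (cases n) (simp_all add: x)
  have "composition (dropWhile (\<lambda>x. x = 1) xs)"
    using adm by (auto simp: composition_def dest: set_dropWhileD)
  then show "composition (if x = 2 then dropWhile (\<lambda>x. x = 1) xs else (x - 1) # xs)"
    using adm by auto
qed simp

lemma butlast_dropWhile: "butlast (dropWhile P xs) = dropWhile P (butlast xs)"
  by (induction xs) auto

lemma init_fin: "init (fin a) = fin (init a)"
proof (cases "entries a")
  case Nil
  then show ?thesis by (simp add: entries_eq_Nil)
next
  case (Cons x xs)
  show ?thesis
  proof (cases "xs = []")
    case True
    have "init a = empty_comp"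
      by (simp add: entries_eq_Nil[symmetric] init.rep_eq Cons True)
    moreover have "init (fin a) = empty_comp"
      by (simp add: entries_eq_Nil[symmetric] init.rep_eq entries_fin[OF Cons] True)
    ultimately show ?thesis by simp
  next
    case False
    have i: "entries (init a) = x # butlast xs" by (simp add: init.rep_eq Cons False)
    show ?thesis
      by (rule iffD1[OF entries_inject])
        (simp add: init.rep_eq[of "fin a"] entries_fin[OF Cons] entries_fin[OF i] butlast_dropWhile False)
  qed
qed

lemma mid_dual: "mid (dual a) = dual (mid a)"
proof -
  have "mid (dual a) = init (dual (init a))" by (simp add: mid_def fin_def)
  also have "\<dots> = dual (fin (init a))" by (simp add: fin_def)
  finally show ?thesis by (simp add: mid_def init_fin)
qed

lemma init_dual: "init (dual a) = dual (fin a)" by (simp add: fin_def)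

lemma fin_dual: "fin (dual a) = dual (init a)" by (simp add: fin_def)

definition complete_to :: "nat \<Rightarrow> adm_comp \<Rightarrow> adm_comp" where
  "complete_to k b = Adm (entries b @ [k - weight b])"

lemma entries_complete_to:
  assumes "weight b < k" "2 \<le> k"
  shows "entries (complete_to k b) = entries b @ [k - weight b]"
proof -
  have "admissible (entries b @ [k - weight b])"
    using assms admissible_entries[of b]
    by (cases "entries b") (auto simp: admissible_def weight_def)
  then show ?thesis by (simp add: complete_to_def Adm_inverse)
qed

lemma init_complete_to: "weight b < k \<Longrightarrow> 2 \<le> k \<Longrightarrow> init (complete_to k b) = b"
  by (rule iffD1[OF entries_inject]) (simp add: init.rep_eq entries_complete_to)

lemma weight_complete_to: "weight b < k \<Longrightarrow> 2 \<le> k \<Longrightarrow> weight (complete_to k b) = k"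
  by (simp add: weight_def[of "complete_to k b"] entries_complete_to) (simp add: weight_def)

lemma complete_to_init: "a \<noteq> empty_comp \<Longrightarrow> complete_to (weight a) (init a) = a"
proof -
  assume "a \<noteq> empty_comp"
  then obtain b y where "entries a = b @ [y]"
    using entries_eq_Nil rev_exhaust by metis
  then show ?thesis
    by (metis (no_types, lifting) complete_to_def init.rep_eq weight_def sum_list.append
        butlast_snoc add_diff_cancel_left' entries_inverse sum_list.Cons sum_list.Nil add.right_neutral)
qed

lemma weight_ge_2: "a \<noteq> empty_comp \<Longrightarrow> 2 \<le> weight a"
  using admissible_entries[of a] entries_eq_Nil[of a]
  by (cases "entries a") (auto simp: admissible_def weight_def)

function delta_on :: "adm_comp \<Rightarrow> adm_comp \<Rightarrow>\<^sub>0 int" where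
  "delta_on a = (if a = empty_comp then frag_of empty_comp
     else frag_extend (\<lambda>b. frag_of (complete_to (weight a) b))
       (delta_on (init a) + delta_on (mid a) + delta_on (fin a)))"
  by auto
termination
  by (relation "measure weight") (auto simp: weight_init_less weight_mid_less weight_fin_less)

declare delta_on.simps [simp del]

lemma keys_sum3_less:
  assumes "a \<noteq> empty_comp"
    and "Poly_Mapping.keys x \<subseteq> adm_of_weight (weight (init a))"
    and "Poly_Mapping.keys y \<subseteq> adm_of_weight (weight (mid a))"
    and "Poly_Mapping.keys z \<subseteq> adm_of_weight (weight (fin a))"
    and "b \<in> Poly_Mapping.keys (x + y + z)"
  shows "weight b < weight a"
proof -
  have "b \<in> Poly_Mapping.keys x \<union> Poly_Mapping.keys y \<union> Poly_Mapping.keys z"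
    using assms(5) keys_add[of "x + y" z] keys_add[of x y] by blast
  then have "weight b \<in> {weight (init a), weight (mid a), weight (fin a)}"
    using assms(2-4) unfolding adm_of_weight_def by blast
  then show ?thesis
    using weight_init_less[OF assms(1)] weight_mid_less[OF assms(1)] weight_fin_less[OF assms(1)]
    by auto
qed

lemma keys_delta_on: "Poly_Mapping.keys (delta_on a) \<subseteq> adm_of_weight (weight a)"
proof (induction a rule: delta_on.induct)
  case (1 a)
  show ?case
  proof (cases "a = empty_comp")
    case True
    then show ?thesis by (simp add: delta_on.simps[of empty_comp] adm_of_weight_def)
  next
    case False
    let ?s = "delta_on (init a) + delta_on (mid a) + delta_on (fin a)"
    have "weight b < weight a" if "b \<in> Poly_Mapping.keys ?s" for b
      using keys_sum3_less[OF False 1[OF False] that] .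
    then show ?thesis
      using keys_frag_extend[of "\<lambda>b. frag_of (complete_to (weight a) b)" ?s] False weight_ge_2[OF False]
      by (auto simp: delta_on.simps[of a] adm_of_weight_def weight_complete_to)
  qed
qed

lemma frag_extend_comp:
  "frag_extend f (frag_extend g x) = frag_extend (\<lambda>i. frag_extend f (g i)) x"
  by (simp add: frag_extend_def[of g] frag_extend_sum frag_extend_cmul o_def frag_extend_def[of "\<lambda>i. frag_extend f (g i)"])

lemma init_delta_on:
  assumes "a \<noteq> empty_comp"
  shows "init_lin (delta_on a) = delta_on (init a) + delta_on (mid a) + delta_on (fin a)"
proof -
  let ?s = "delta_on (init a) + delta_on (mid a) + delta_on (fin a)"
  have "weight b < weight a" if "b \<in> Poly_Mapping.keys ?s" for b
    using keys_sum3_less[OF assms keys_delta_on keys_delta_on keys_delta_on that] .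
  then have "frag_extend (\<lambda>b. frag_of (init (complete_to (weight a) b))) ?s = frag_extend frag_of ?s"
    using weight_ge_2[OF assms] by (intro frag_extend_eq) (simp add: init_complete_to)
  then show ?thesis
    using assms frag_expansion[of ?s, symmetric]
    by (simp add: init_lin_def delta_on.simps[of a] frag_extend_comp)
qed

lemma delta_on_dual: "delta_on (dual a) = delta_on a"
proof (induction a rule: delta_on.induct)
  case (1 a)
  show ?case
  proof (cases "a = empty_comp")
    case False
    then show ?thesis
      using 1[OF False]
      by (simp add: delta_on.simps[of a] delta_on.simps[of "dual a"] init_dual mid_dual fin_dual ac_simps)
  qed simp
qed

lemma delta_on_rep_class: "delta_on (rep_class (cls a)) = delta_on a"
proof -
  have "dual_equiv (rep_class (cls a)) a"
    by (metis Quotient3_def Quotient3_dual_class dual_class.abs_eq_iff)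
  then show ?thesis by (metis dual_equiv_def delta_on_dual)
qed

lemma module_frag: "module (frag_cmul :: int \<Rightarrow> ('a \<Rightarrow>\<^sub>0 int) \<Rightarrow> _)"
  by unfold_locales (simp_all add: frag_cmul_distrib frag_cmul_distrib2)

lemma module_hom_frag_extend: "module_hom frag_cmul frag_cmul (frag_extend f)"
  by (simp add: module_hom_def module_hom_axioms_def module_frag frag_extend_add frag_extend_cmul)

lemma is_delta_exists: "is_delta (frag_extend (\<lambda>c. delta_on (rep_class c)))"
  unfolding is_delta_def
proof (intro conjI allI impI)
  show "module_hom frag_cmul frag_cmul (frag_extend (\<lambda>c. delta_on (rep_class c)))"
    by (rule module_hom_frag_extend)
  show "frag_extend (\<lambda>c. delta_on (rep_class c)) ` supported_in (classes_of_weight k)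
      \<subseteq> supported_in (adm_of_weight k)" for k
  proof
    fix y assume "y \<in> frag_extend (\<lambda>c. delta_on (rep_class c)) ` supported_in (classes_of_weight k)"
    then obtain x where y: "y = frag_extend (\<lambda>c. delta_on (rep_class c)) x"
      and x: "Poly_Mapping.keys x \<subseteq> classes_of_weight k"
      unfolding supported_in_def by blast
    have "Poly_Mapping.keys (delta_on (rep_class c)) \<subseteq> adm_of_weight k"
      if c: "c \<in> Poly_Mapping.keys x" for c
    proof -
      obtain a where "c = cls a" "weight a = k"
        using c x unfolding classes_of_weight_def adm_of_weight_def by blast
      then show ?thesis
        using keys_delta_on[of a] by (simp add: delta_on_rep_class)
    qed
    then have "Poly_Mapping.keys y \<subseteq> adm_of_weight k"
      unfolding y by (intro subset_trans[OF keys_frag_extend] UN_least)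
    then show "y \<in> supported_in (adm_of_weight k)"
      by (simp add: supported_in_def)
  qed
qed (simp_all add: delta_on_rep_class init_delta_on delta_on.simps[of empty_comp])

lemma init_lin_inj:
  assumes "Poly_Mapping.keys x \<subseteq> adm_of_weight k" "0 < k"
  shows "frag_extend (\<lambda>b. frag_of (complete_to k b)) (init_lin x) = x"
proof -
  have "frag_extend (\<lambda>b. frag_of (complete_to k (init b))) x = frag_extend frag_of x"
  proof (rule frag_extend_eq)
    fix b assume "b \<in> Poly_Mapping.keys x"
    then have "weight b = k" using assms by (auto simp: adm_of_weight_def)
    moreover then have "b \<noteq> empty_comp" using assms by (auto simp: weight_def empty_comp.rep_eq)
    ultimately show "frag_of (complete_to k (init b)) = frag_of b"
      using complete_to_init by metis
  qed
  then show ?thesis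
    using frag_expansion[of x, symmetric] by (simp add: init_lin_def frag_extend_comp)
qed

lemma is_delta_unique:
  assumes "is_delta D" "is_delta E"
  shows "D = E"
proof -
  have keys: "Poly_Mapping.keys (F (frag_of (cls a))) \<subseteq> adm_of_weight (weight a)" if "is_delta F" for F a
  proof -
    have "frag_of (cls a) \<in> supported_in (classes_of_weight (weight a))"
      by (simp add: supported_in_def classes_of_weight_def adm_of_weight_def)
    with that show ?thesis unfolding is_delta_def supported_in_def by blast
  qed
  have basis: "D (frag_of (cls a)) = E (frag_of (cls a))" for a
  proof (induction a rule: measure_induct_rule[of weight])
    case (less a)
    show ?case
    proof (cases "a = empty_comp")
      case True
      with assms show ?thesis by (simp add: is_delta_def)
    next
      case False
      then have "init_lin (D (frag_of (cls a))) = init_lin (E (frag_of (cls a)))"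
        using assms less[OF weight_init_less[OF False]] less[OF weight_mid_less[OF False]]
          less[OF weight_fin_less[OF False]]
        unfolding is_delta_def by metis
      moreover have "0 < weight a" using weight_ge_2[OF False] by simp
      ultimately show ?thesis
        using init_lin_inj[OF keys[OF assms(1), of a]] init_lin_inj[OF keys[OF assms(2), of a]]
        by metis
    qed
  qed
  have cls: "\<exists>a. c = cls a" for c
    by (metis Quotient3_abs_rep Quotient3_dual_class)
  interpret D: module_hom frag_cmul frag_cmul D using assms(1) by (simp add: is_delta_def)
  interpret E: module_hom frag_cmul frag_cmul E using assms(2) by (simp add: is_delta_def)
  have "D x = E x" for x
    using subset_UNIV[of "Poly_Mapping.keys x"]
  proof (induction rule: frag_induction)
    case (one c)
    then show ?case using cls[of c] basis by auto
  qed (simp_all add: D.diff E.diff)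
  then show ?thesis by blast
qed

theorem ex1_delta: "\<exists>!D. is_delta D"
  using is_delta_exists is_delta_unique by blast

lemma is_delta_delta: "is_delta delta"
  unfolding delta_def by (rule theI'[OF ex1_delta])

end

theory Submission
  imports Defs
begin

text \<open>On \<open>(2, \<dots>, 2)\<close> the maps \<open>init\<close>, \<open>fin\<close> and \<open>mid\<close> remove the last entry, the first
  entry and both, so \<open>d\<^sub>m = \<delta>([2, \<dots>, 2])\<close> satisfies
  \<open>init(d\<^bsub>m+2\<^esub>) = 2 d\<^bsub>m+1\<^esub> + d\<^sub>m\<close>. Since \<open>init\<close> is injective in each
  weight, \<open>d\<^bsub>m+2\<^esub>\<close> arises by appending a 2 to the terms of \<open>2 d\<^bsub>m+1\<^esub>\<close> and a 4 to those
  of \<open>d\<^sub>m\<close>, which is the recursion of the coefficients. The factor 3 comes from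
  \<open>init(d\<^sub>1) = 3 d\<^sub>0\<close>.\<close>

text \<open>By uniqueness, \<open>delta\<close> is the map built from the recursion
  \<open>delta_on\<close>, so it can be computed on representatives.\<close>

lemma delta_cls: "delta (frag_of (cls a)) = delta_on a"
proof -
  have "delta = frag_extend (\<lambda>c. delta_on (rep_class c))"
    using is_delta_unique[OF is_delta_delta is_delta_exists] .
  then have "delta (frag_of (cls a)) = frag_extend (\<lambda>c. delta_on (rep_class c)) (frag_of (cls a))"
    by (rule fun_cong)
  then show ?thesis by (simp only: frag_extend_of delta_on_rep_class)
qed

lemma weight_empty [simp]: "weight empty_comp = 0"
  by (simp add: weight_def empty_comp.rep_eq)

lemma weight_twos [simp]: "weight (twos m) = 2 * m"
  by (simp add: weight_def twos.rep_eq sum_list_replicate)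

lemma twos_0 [simp]: "twos 0 = empty_comp"
  by (simp add: entries_eq_Nil[symmetric] twos.rep_eq)

lemma twos_Suc_neq_empty [simp]: "twos (Suc m) \<noteq> empty_comp"
  by (simp add: entries_eq_Nil[symmetric] twos.rep_eq)

lemma init_twos: "init (twos m) = twos (m - 1)"
  by (rule iffD1[OF entries_inject]) (simp add: init.rep_eq twos.rep_eq butlast_conv_take)

lemma fin_twos: "fin (twos (Suc m)) = twos m"
proof (rule iffD1[OF entries_inject])
  have "entries (twos (Suc m)) = 2 # replicate m 2" by (simp add: twos.rep_eq)
  \<comment> \<open>When the first entry is 2, \<open>fin\<close> also strips the ones right after
    it; here there are none.\<close>
  moreover have "dropWhile (\<lambda>x. x = 1) (replicate m 2) = replicate m (2::nat)"
    by (cases m) auto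
  ultimately show "entries (fin (twos (Suc m))) = entries (twos m)"
    by (simp add: entries_fin twos.rep_eq)
qed

text \<open>The middle term is \<open>mid\<close>. For \<open>m = 0\<close> truncated subtraction
  gives \<open>twos 0\<close>, in agreement with \<open>init\<close> fixing the empty composition,
  so all three terms coincide.\<close>

lemma delta_on_twos_Suc:
  "delta_on (twos (Suc m)) = frag_extend (\<lambda>b. frag_of (complete_to (2 * Suc m) b))
     (delta_on (twos m) + delta_on (twos (m - 1)) + delta_on (twos m))"
  by (subst delta_on.simps) (simp add: init_twos mid_def fin_twos)

lemma num_twos_filter: "num_twos a = length (filter (\<lambda>x. x = 2) (entries a))"
  by (simp add: num_twos_def length_filter_conv_card)

lemma coeff24_empty [simp]: "coeff24 empty_comp = 1"
  by (simp add: coeff24_def num_twos_filter empty_comp.rep_eq)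

text \<open>A 2 appended to a non-empty list keeps the first entry and adds one factor 2. Appended
  to the empty list it becomes the first entry itself, and the coefficient jumps from 1 to
  3.\<close>

lemma coeff24_snoc_2:
  assumes "entries a = entries b @ [2]"
  shows "coeff24 a = (if b = empty_comp then 3 else 2 * coeff24 b)"
  using assms by (cases "entries b") (auto simp: coeff24_def num_twos_filter entries_eq_Nil empty_comp.rep_eq)

lemma coeff24_snoc_4:
  assumes "entries a = entries b @ [4]"
  shows "coeff24 a = coeff24 b"
  using assms by (cases "entries b") (auto simp: coeff24_def num_twos_filter)

lemma adm24_of_weight_0: "adm24_of_weight 0 = {empty_comp}"
proof -
  have "a = empty_comp" if "weight a = 0" for a
    using weight_ge_2[of a] that by force
  then show ?thesis by (auto simp: adm24_of_weight_def empty_comp.rep_eq)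
qed

lemma complete_to_in_adm24:
  assumes "b \<in> adm24_of_weight j" "k = j + 2 \<or> k = j + 4"
  shows "complete_to k b \<in> adm24_of_weight k"
  using assms by (auto simp: adm24_of_weight_def weight_complete_to entries_complete_to)

text \<open>Take \<open>b = init a\<close>; the weight \<open>k\<close> then determines the removed
  last entry, which is 2 or 4.\<close>

lemma adm24_cases:
  assumes "a \<in> adm24_of_weight k" "0 < k"
  obtains j b where "b \<in> adm24_of_weight j" "k = j + 2 \<or> k = j + 4" "a = complete_to k b"
proof -
  have ne: "a \<noteq> empty_comp" and k: "weight a = k"
    using assms by (auto simp: adm24_of_weight_def)
  then obtain xs y where e: "entries a = xs @ [y]"
    using entries_eq_Nil rev_exhaust by metis
  then have "entries (init a) = xs" by (simp add: init.rep_eq)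
  then have "init a \<in> adm24_of_weight (sum_list xs)"
    and "k = sum_list xs + 2 \<or> k = sum_list xs + 4"
    using assms(1) e by (auto simp: adm24_of_weight_def weight_def)
  then show thesis using complete_to_init[OF ne] k that by metis
qed

lemma inj_on_complete_to:
  assumes "2 \<le> k" "\<And>b. b \<in> S \<Longrightarrow> weight b < k"
  shows "inj_on (complete_to k) S"
  using init_complete_to assms by (metis inj_onI)

lemma adm24_of_weight_2: "adm24_of_weight 2 = {complete_to 2 empty_comp}"
proof -
  have "complete_to 2 empty_comp \<in> adm24_of_weight 2"
    by (rule complete_to_in_adm24[of _ 0]) (simp_all add: adm24_of_weight_0)
  moreover have "a = complete_to 2 empty_comp" if "a \<in> adm24_of_weight 2" for a
    using that by (rule adm24_cases) (auto simp: adm24_of_weight_0)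
  ultimately show ?thesis by blast
qed

text \<open>The two images collect the compositions ending in 2 and in 4, respectively.\<close>

lemma adm24_of_weight_add_4:
  "adm24_of_weight (k + 4) =
     complete_to (k + 4) ` adm24_of_weight (k + 2) \<union> complete_to (k + 4) ` adm24_of_weight k"
proof (rule equalityI)
  show "adm24_of_weight (k + 4) \<subseteq>
     complete_to (k + 4) ` adm24_of_weight (k + 2) \<union> complete_to (k + 4) ` adm24_of_weight k"
  proof
    fix a assume "a \<in> adm24_of_weight (k + 4)"
    then obtain j b where b: "b \<in> adm24_of_weight j" "k + 4 = j + 2 \<or> k + 4 = j + 4"
      "a = complete_to (k + 4) b" by (rule adm24_cases) auto
    then have "j = k + 2 \<or> j = k" by auto
    with b show "a \<in> complete_to (k + 4) ` adm24_of_weight (k + 2) \<union>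
      complete_to (k + 4) ` adm24_of_weight k" by auto
  qed
qed (auto intro: complete_to_in_adm24)

definition sum24 :: "nat \<Rightarrow> adm_comp \<Rightarrow>\<^sub>0 int" where
  "sum24 k = (\<Sum>a \<in> adm24_of_weight k. frag_cmul (coeff24 a) (frag_of a))"

lemma sum24_0: "sum24 0 = frag_of empty_comp"
  by (simp add: sum24_def adm24_of_weight_0)

lemma sum24_2: "sum24 2 = frag_cmul 3 (frag_of (complete_to 2 empty_comp))"
  by (simp add: sum24_def adm24_of_weight_2 coeff24_snoc_2[of _ empty_comp] entries_complete_to)

lemma frag_extend_sum24:
  "frag_extend (\<lambda>b. frag_of (f b)) (sum24 k) =
     (\<Sum>b \<in> adm24_of_weight k. frag_cmul (coeff24 b) (frag_of (f b)))"
  by (simp add: sum24_def frag_extend_sum finite_adm24 frag_extend_cmul)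

text \<open>Split by the last entry: a final 2 doubles the coefficient, hence
  \<open>sum24 (k + 2)\<close> occurs twice; a final 4 preserves it.\<close>

lemma sum24_add_4:
  "sum24 (k + 4) = frag_extend (\<lambda>b. frag_of (complete_to (k + 4) b))
     (sum24 (k + 2) + sum24 k + sum24 (k + 2))"
proof -
  let ?c = "complete_to (k + 4)" and ?S = "adm24_of_weight (k + 2)" and ?T = "adm24_of_weight k"
  let ?f = "\<lambda>a. frag_cmul (coeff24 a) (frag_of a)"
  have w: "weight b = k + 2" if "b \<in> ?S" for b using that by (simp add: adm24_of_weight_def)
  have w': "weight b = k" if "b \<in> ?T" for b using that by (simp add: adm24_of_weight_def)
  have inj: "inj_on ?c (?S \<union> ?T)"
    by (rule inj_on_complete_to) (use w w' in fastforce)+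
  \<comment> \<open>The weights \<open>k + 2\<close> and \<open>k\<close> differ, and injectivity on
    the union carries disjointness over to the images.\<close>
  have "?S \<inter> ?T = {}" using w w' by fastforce
  then have "?c ` ?S \<inter> ?c ` ?T = {}"
    using inj_on_image_Int[OF inj, of ?S ?T] by simp
  then have "sum24 (k + 4) = sum ?f (?c ` ?S) + sum ?f (?c ` ?T)"
    unfolding sum24_def adm24_of_weight_add_4 by (intro sum.union_disjoint) (simp_all add: finite_adm24)
  also have "sum ?f (?c ` ?S) = (\<Sum>b\<in>?S. ?f (?c b))"
    using inj by (subst sum.reindex) (auto intro: inj_on_subset)
  also have "\<dots> = (\<Sum>b\<in>?S. frag_cmul (coeff24 b) (frag_of (?c b)) + frag_cmul (coeff24 b) (frag_of (?c b)))"
  proof (rule sum.cong)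
    fix b assume "b \<in> ?S"
    then have b: "weight b = k + 2" by (rule w)
    \<comment> \<open>Positive weight rules out the exceptional value 3 in
      \<open>coeff24_snoc_2\<close>.\<close>
    then have "b \<noteq> empty_comp" by auto
    with b have "coeff24 (?c b) = coeff24 b + coeff24 b"
      by (simp add: coeff24_snoc_2[of _ b] entries_complete_to)
    then show "?f (?c b) = frag_cmul (coeff24 b) (frag_of (?c b)) + frag_cmul (coeff24 b) (frag_of (?c b))"
      by (simp only: frag_cmul_distrib)
  qed simp
  also have "sum ?f (?c ` ?T) = (\<Sum>b\<in>?T. ?f (?c b))"
    using inj by (subst sum.reindex) (auto intro: inj_on_subset)
  also have "\<dots> = (\<Sum>b\<in>?T. frag_cmul (coeff24 b) (frag_of (?c b)))"
    by (rule sum.cong) (auto dest!: w' simp: coeff24_snoc_4 entries_complete_to)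
  finally show ?thesis
    by (simp add: frag_extend_add frag_extend_sum24 sum.distrib ac_simps)
qed

text \<open>Both sides satisfy the same second-order recursion, so it suffices to compare the values
  at 0 and 1.\<close>

lemma delta_on_twos: "delta_on (twos m) = sum24 (2 * m)"
proof (induction m rule: induct_nat_012)
  case 0
  show ?case by (simp add: sum24_0 delta_on.simps)
next
  case 1
  have "frag_cmul 3 x = x + x + x" for x :: "adm_comp \<Rightarrow>\<^sub>0 int"
    using frag_cmul_distrib[of 2 1 x] frag_cmul_distrib[of 1 1 x] by simp
  then show ?case
    using delta_on_twos_Suc[of 0]
    by (simp add: delta_on.simps[of empty_comp] frag_extend_add sum24_2)
next
  case (ge2 m)
  then show ?case
    using delta_on_twos_Suc[of "Suc m"] sum24_add_4[of "2 * m"] by (simp add: numeral_eq_Suc)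
qed

theorem theorem14:
  fixes m :: nat
  shows "delta (frag_of (cls (twos m))) =
    (\<Sum>a \<in> adm24_of_weight (2 * m). frag_cmul (coeff24 a) (frag_of a))"
  by (simp add: delta_cls delta_on_twos sum24_def)

end
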